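(* Let $\mathcal{H}$ be a complex Hilbert space and let $A\in\mathcal{B}(\mathcal{H})$. If $f:[0,\infty)\to[0,\infty)$ is an operator convex function, then \[\frac{1}{2}\left\| f\left( \frac{3|A|+|A^{*}|}{4} \right)+f\left( \frac{|A|+3|A^{*}|}{4} \right) \right\|\le \left\| \int_{0}^{1} f\left( t|A|+(1-t)|A^{*}| \right)dt \right\|.\]
   Context: $\mathcal{B}(\mathcal{H})$ is the $C^*$-algebra of bounded linear operators on the complex Hilbert space $\mathcal{H}$; $\|\cdot\|$ is the operator norm; $|A|=(A^*A)^{1/2}$ and $|A^*|=(AA^* )^{1/2}$. A function $f:J\to\mathbb{R}$ on an interval $J$ is operator convex if it is continuous and $f\left(\frac{X+Y}{2}\right)\le\frac{f(X)+f(Y)}{2}$ (in the positive semi-definite order) for all self adjoint operators $X,Y$ with spectra in $J$. For $X$ self adjoint with spectrum in $J$, $f(X)$ is defined by functional calculus. *)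

theory Defs
  imports "HOL-Analysis.Analysis" "HOL-Computational_Algebra.Polynomial"
begin

text \<open>
  Complex Hilbert spaces, over an arbitrary carrier type. The underlying real Banach space is the
  library's, so that real bounded operators, their operator norm and vector-valued integrals
  are available; the inner product is linear in its first argument and induces the norm.
\<close>

class chilbert_space = banach +
  fixes scaleC :: "complex \<Rightarrow> 'a \<Rightarrow> 'a" (infixr "*\<^sub>C" 75)
    and cinner :: "'a \<Rightarrow> 'a \<Rightarrow> complex"
  assumes scaleC_add_right: "c *\<^sub>C (x + y) = c *\<^sub>C x + c *\<^sub>C y"
    and scaleC_add_left: "(c + d) *\<^sub>C x = c *\<^sub>C x + d *\<^sub>C x"
    and scaleC_scaleC: "c *\<^sub>C (d *\<^sub>C x) = (c * d) *\<^sub>C x"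
    and scaleR_scaleC: "r *\<^sub>R x = complex_of_real r *\<^sub>C x"
    and cinner_add_left: "cinner (x + y) z = cinner x z + cinner y z"
    and cinner_scaleC_left: "cinner (c *\<^sub>C x) y = c * cinner x y"
    and cinner_commute: "cinner x y = cnj (cinner y x)"
    and cinner_self: "cinner x x = complex_of_real ((norm x)\<^sup>2)"

text \<open>
  \<open>'a \<Rightarrow>\<^sub>L 'a\<close> consists of the bounded real-linear operators; \<open>bounded_ops\<close> is the
  algebra of the complex-linear ones. The library norm is the operator norm on both.
\<close>

definition bounded_ops :: "('a::chilbert_space \<Rightarrow>\<^sub>L 'a) set" where
  "bounded_ops = {A. \<forall>c x. blinfun_apply A (c *\<^sub>C x) = c *\<^sub>C blinfun_apply A x}"

definition op_adj :: "('a::chilbert_space \<Rightarrow>\<^sub>L 'a) \<Rightarrow> 'a \<Rightarrow>\<^sub>L 'a" where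
  "op_adj A = (THE B. B \<in> bounded_ops \<and>
     (\<forall>x y. cinner (blinfun_apply A x) y = cinner x (blinfun_apply B y)))"

definition self_adjoint :: "('a::chilbert_space \<Rightarrow>\<^sub>L 'a) \<Rightarrow> bool" where
  "self_adjoint X \<longleftrightarrow> X \<in> bounded_ops \<and> op_adj X = X"

definition positive_op :: "('a::chilbert_space \<Rightarrow>\<^sub>L 'a) \<Rightarrow> bool" where
  "positive_op X \<longleftrightarrow> X \<in> bounded_ops \<and>
     (\<forall>x. Im (cinner (blinfun_apply X x) x) = 0 \<and> 0 \<le> Re (cinner (blinfun_apply X x) x))"

definition op_le :: "('a::chilbert_space \<Rightarrow>\<^sub>L 'a) \<Rightarrow> ('a \<Rightarrow>\<^sub>L 'a) \<Rightarrow> bool" where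
  "op_le X Y \<longleftrightarrow> positive_op (Y - X)"

text \<open>The complex numbers \<open>c\<close> for which \<open>X - c I\<close> has no two-sided inverse in \<open>bounded_ops\<close>.\<close>

definition spectrum :: "('a::chilbert_space \<Rightarrow>\<^sub>L 'a) \<Rightarrow> complex set" where
  "spectrum X = {c. \<not> (\<exists>B \<in> bounded_ops. \<forall>x.
     blinfun_apply B (blinfun_apply X x - c *\<^sub>C x) = x \<and>
     blinfun_apply X (blinfun_apply B x) - c *\<^sub>C blinfun_apply B x = x)}"

definition poly_op :: "real poly \<Rightarrow> ('a::chilbert_space \<Rightarrow>\<^sub>L 'a) \<Rightarrow> 'a \<Rightarrow>\<^sub>L 'a" where
  "poly_op p X = (\<Sum>i\<le>degree p. coeff p i *\<^sub>R (((o\<^sub>L) X ^^ i) id_blinfun))"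

text \<open>
  Continuous functional calculus for self-adjoint \<open>X\<close> (whose spectrum is real and compact) and real
  \<open>f\<close> continuous on the spectrum: \<open>f(X)\<close> is the operator-norm limit of \<open>p\<^sub>n(X)\<close> for any
  polynomials \<open>p\<^sub>n\<close> converging to \<open>f\<close> uniformly on the spectrum. Only the values of
  \<open>f\<close> on the spectrum matter, so partial functions are represented by arbitrary total extensions.
\<close>

definition cfc :: "(real \<Rightarrow> real) \<Rightarrow> ('a::chilbert_space \<Rightarrow>\<^sub>L 'a) \<Rightarrow> 'a \<Rightarrow>\<^sub>L 'a" where
  "cfc f X = (THE Y. \<forall>p :: nat \<Rightarrow> real poly.
     uniform_limit {s. complex_of_real s \<in> spectrum X} (\<lambda>n. poly (p n)) f sequentially \<longrightarrow>
     (\<lambda>n. poly_op (p n) X) \<longlonglongrightarrow> Y)"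

definition abs_op :: "('a::chilbert_space \<Rightarrow>\<^sub>L 'a) \<Rightarrow> 'a \<Rightarrow>\<^sub>L 'a" where
  "abs_op A = cfc sqrt (op_adj A o\<^sub>L A)"

text \<open>
  Operator convexity refers to the operators on one Hilbert space, given by the type argument.
\<close>

definition operator_convex_on ::
    "'a::chilbert_space itself \<Rightarrow> real set \<Rightarrow> (real \<Rightarrow> real) \<Rightarrow> bool" where
  "operator_convex_on _ J f \<longleftrightarrow> is_interval J \<and> continuous_on J f \<and>
     (\<forall>X Y :: 'a \<Rightarrow>\<^sub>L 'a. self_adjoint X \<and> self_adjoint Y \<and>
        spectrum X \<subseteq> complex_of_real ` J \<and> spectrum Y \<subseteq> complex_of_real ` J \<longrightarrow>
        op_le (cfc f ((X + Y) /\<^sub>R 2)) ((cfc f X + cfc f Y) /\<^sub>R 2))"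

end

theory Submission
  imports Defs "HOL-Computational_Algebra.Fundamental_Theorem_Algebra"
begin

text \<open>
  Write \<open>P = |A|\<close>, \<open>Q = |A\<^sup>*|\<close> and \<open>g(t) = f(t P + (1 - t) Q)\<close> for \<open>t\<close> in the unit interval. The
  theorem is an operator version of the Hermite--Hadamard inequality on the halves \<open>[0, 1/2]\<close> and
  \<open>[1/2, 1]\<close>, whose midpoints 1/4 and 3/4 give the two operators on the left-hand side. For a fixed
  vector \<open>x\<close> the real function \<open>t \<mapsto> \<langle>g(t) x, x\<rangle>\<close> is continuous and, by operator convexity of \<open>f\<close>,
  midpoint convex. Hence \<open>\<langle>(g(1/4) + g(3/4)) x, x\<rangle> / 2\<close> is at most its integral
  (two_point_hermite_hadamard), which is the form of \<open>\<integral> g\<close> at \<open>x\<close> because evaluating forms at \<open>x\<close> is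
  a bounded linear functional. Since \<open>f \<ge> 0\<close>, the operators \<open>g(t)\<close> are positive, and if the smaller of
  two forms belongs to a positive operator, the inequality passes to the norms
  (norm_mono_positive_op).

  What remains is the functional calculus: \<open>g(t)\<close> must be positive and norm-continuous in \<open>t\<close>, and
  the convexity hypothesis needs the spectra to be in the half-line. Adjoints come from the Riesz
  representation, and a coercive operator is invertible (coercive_invertible), so self-adjoint
  operators have real spectrum and positive ones have spectrum in \<open>{0..\<parallel>X\<parallel>}\<close>. The calculus
  rests on the bound \<open>\<parallel>p(X)\<parallel> \<le> sup |p|\<close> for real polynomials \<open>p\<close>, with the supremum over the
  real spectrum of \<open>X\<close> (norm_poly_op_le). The infimum of the form of a self-adjoint operator over
  the unit sphere is one of its spectral points (form_lower_bound_in_spectrum). For \<open>p(X)\<close>,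
  factoring over the reals identifies this point as a value of \<open>p\<close> on the spectrum of \<open>X\<close>
  (invertible_poly_op). So a polynomial that is nonnegative on the spectrum gives a positive
  operator, and the bound follows from the case of \<open>c\<^sup>2 - p\<^sup>2\<close>. Positivity and continuity then pass
  to \<open>f\<close> by Weierstrass approximation.
\<close>

section \<open>The real inner product\<close>

definition re_inner :: "'a::chilbert_space \<Rightarrow> 'a \<Rightarrow> real" where
  "re_inner x y = Re (cinner x y)"

lemma cinner_scaleC_right: "cinner x (c *\<^sub>C y) = cnj c * cinner x y"
  by (metis cinner_commute cinner_scaleC_left complex_cnj_mult)

lemma re_inner_commute: "re_inner x y = re_inner y x"
  unfolding re_inner_def by (subst cinner_commute) simp

lemma cinner_add_right: "cinner x (y + z) = cinner x y + cinner x z"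
  by (metis cinner_add_left cinner_commute complex_cnj_add)

lemma re_inner_add_left: "re_inner (x + y) z = re_inner x z + re_inner y z"
  by (simp add: re_inner_def cinner_add_left)

lemma re_inner_add_right: "re_inner x (y + z) = re_inner x y + re_inner x z"
  by (metis re_inner_add_left re_inner_commute)

lemma re_inner_scaleR_left: "re_inner (r *\<^sub>R x) y = r * re_inner x y"
  by (simp add: re_inner_def scaleR_scaleC cinner_scaleC_left)

lemma re_inner_scaleR_right: "re_inner x (r *\<^sub>R y) = r * re_inner x y"
  by (metis re_inner_scaleR_left re_inner_commute)

lemma re_inner_self: "re_inner x x = (norm x)\<^sup>2"
  by (simp add: re_inner_def cinner_self)

lemma re_inner_diff_left: "re_inner (x - y) z = re_inner x z - re_inner y z"
  using re_inner_add_left[of "x - y" y z] by simp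

lemma re_inner_diff_right: "re_inner x (y - z) = re_inner x y - re_inner x z"
  by (metis re_inner_diff_left re_inner_commute)

lemma re_inner_eqI:
  assumes "\<And>x. re_inner x y = re_inner x z"
  shows "y = z"
  using assms[of "y - z"] re_inner_self[of "y - z"] by (simp add: re_inner_diff_right)

lemma norm_add_squared: "(norm (x + y))\<^sup>2 = (norm x)\<^sup>2 + 2 * re_inner x y + (norm y)\<^sup>2"
  for x y :: "'a::chilbert_space"
  by (simp add: re_inner_add_left re_inner_add_right re_inner_commute[of y x] flip: re_inner_self)

lemma nonneg_quadratic_discriminant:
  fixes a b c :: real
  assumes "\<And>t. 0 \<le> a + 2 * b * t + c * t\<^sup>2"
  shows "b\<^sup>2 \<le> a * c"
proof (cases "c = 0")
  case True
  have "b = 0"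
  proof (rule ccontr)
    assume "b \<noteq> 0"
    then show False using assms[of "- (a + 1) / (2 * b)"] True by simp
  qed
  then show ?thesis using True by simp
next
  case False
  have "c > 0"
  proof (rule ccontr)
    assume "\<not> c > 0"
    with False have c: "c < 0" by simp
    \<comment> \<open>With a negative leading coefficient the quadratic is negative at this large \<open>t\<close>.\<close>
    define t where "t = 1 + (\<bar>a\<bar> + 2 * \<bar>b\<bar>) / (- c)"
    have t: "t \<ge> 1" using c by (simp add: t_def divide_nonneg_neg)
    have ct: "c * t = c - (\<bar>a\<bar> + 2 * \<bar>b\<bar>)" using c by (simp add: t_def field_simps)
    have "a + 2 * b * t + c * t\<^sup>2 = a + t * (2 * b + c - \<bar>a\<bar> - 2 * \<bar>b\<bar>)"
    proof -
      have "c * t\<^sup>2 = t * (c * t)" by (simp add: power2_eq_square)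
      then show ?thesis by (simp only: ct) (simp add: algebra_simps)
    qed
    also have "\<dots> \<le> a + t * (c - \<bar>a\<bar>)" using t by (intro add_left_mono mult_left_mono) auto
    also have "\<dots> \<le> a + 1 * (c - \<bar>a\<bar>)"
      using t c by (intro add_left_mono mult_right_mono_neg) auto
    also have "\<dots> < 0" using c by simp
    finally show False using assms[of t] by simp
  qed
  have "0 \<le> a + 2 * b * (- b / c) + c * (- b / c)\<^sup>2" by (rule assms)
  also have "\<dots> = a - b\<^sup>2 / c" using False by (simp add: power2_eq_square)
  finally show ?thesis using \<open>c > 0\<close> by (simp add: field_simps)
qed

lemma re_inner_bound: "\<bar>re_inner x y\<bar> \<le> norm x * norm y"
proof -
  have "0 \<le> (norm x)\<^sup>2 + 2 * re_inner x y * t + (norm y)\<^sup>2 * t\<^sup>2" for t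
  proof -
    have "(norm (x + t *\<^sub>R y))\<^sup>2 = (norm x)\<^sup>2 + 2 * re_inner x y * t + (norm y)\<^sup>2 * t\<^sup>2"
      by (simp add: norm_add_squared re_inner_scaleR_right power_mult_distrib)
    then show ?thesis by (metis zero_le_power2)
  qed
  then have "(re_inner x y)\<^sup>2 \<le> (norm x * norm y)\<^sup>2"
    using nonneg_quadratic_discriminant by (metis power_mult_distrib)
  then show ?thesis by (metis abs_le_square_iff abs_mult abs_norm_cancel)
qed

lemma bounded_bilinear_re_inner: "bounded_bilinear (re_inner :: 'a::chilbert_space \<Rightarrow> _)"
proof
  show "\<exists>K. \<forall>a b :: 'a. norm (re_inner a b) \<le> norm a * norm b * K"
    by (rule exI[of _ 1]) (simp add: re_inner_bound)
qed (simp_all add: re_inner_add_left re_inner_add_right re_inner_scaleR_left re_inner_scaleR_right)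

lemma norm_diff_squared: "(norm (x - y))\<^sup>2 = (norm x)\<^sup>2 - 2 * re_inner x y + (norm y)\<^sup>2"
  for x y :: "'a::chilbert_space"
  by (simp add: re_inner_diff_left re_inner_diff_right re_inner_commute[of y x] flip: re_inner_self)

section \<open>Riesz representation and adjoints\<close>

text \<open>
  The representing vector minimises \<open>\<parallel>x\<parallel>\<^sup>2 - 2 \<phi> x\<close>. By the parallelogram law every minimising sequence is
  Cauchy, and the vanishing first variation at the limit \<open>w\<close> says \<open>\<phi> y = re_inner y w\<close>.
\<close>

lemma riesz_representation:
  fixes \<phi> :: "'a::chilbert_space \<Rightarrow> real"
  assumes "bounded_linear \<phi>"
  shows "\<exists>w. \<forall>y. \<phi> y = re_inner y w"
proof -
  interpret \<phi>: bounded_linear \<phi> by fact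
  obtain K where K: "\<And>x. \<bar>\<phi> x\<bar> \<le> norm x * K" using \<phi>.bounded by auto
  define J where "J x = (norm x)\<^sup>2 - 2 * \<phi> x" for x
  define I where "I = Inf (range J)"
  have "- K\<^sup>2 \<le> J x" for x
  proof -
    have "0 \<le> (norm x - K)\<^sup>2" by simp
    then show ?thesis using K[of x] unfolding J_def by (simp add: power2_eq_square algebra_simps)
  qed
  then have bdd: "bdd_below (range J)" by (intro bdd_belowI[of _ "- K\<^sup>2"]) auto
  have I_le: "I \<le> J x" for x unfolding I_def by (intro cInf_lower bdd) auto
  have "\<exists>x. J x < I + inverse (real (Suc n))" for n
  proof -
    have "Inf (range J) < I + inverse (real (Suc n))" by (simp add: I_def)
    then show ?thesis using cInf_lessD by blast
  qed
  then obtain X where X: "\<And>n. J (X n) < I + inverse (real (Suc n))" by metis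
  have mid: "(norm (x - y))\<^sup>2 = 2 * (J x + J y - 2 * J ((1 / 2) *\<^sub>R (x + y)))" for x y
    unfolding J_def \<phi>.scaleR \<phi>.add norm_scaleR power_mult_distrib norm_add_squared norm_diff_squared
    by (simp add: power2_eq_square algebra_simps)
  have "Cauchy X"
  proof (rule metric_CauchyI)
    fix e :: real assume e: "e > 0"
    then obtain M where M: "inverse (real (Suc M)) < e\<^sup>2 / 4"
      using reals_Archimedean[of "e\<^sup>2 / 4"] by auto
    have "dist (X m) (X n) < e" if "m \<ge> M" "n \<ge> M" for m n
    proof -
      have *: "J (X k) < I + e\<^sup>2 / 4" if "k \<ge> M" for k
      proof -
        have "inverse (real (Suc k)) \<le> inverse (real (Suc M))" using that by (simp add: field_simps)
        then show ?thesis using X[of k] M by linarith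
      qed
      have "(norm (X m - X n))\<^sup>2 < e\<^sup>2"
        unfolding mid
        using I_le[of "(1 / 2) *\<^sub>R (X m + X n)"] *[OF that(1)] *[OF that(2)]
        by argo
      then show ?thesis using e by (simp add: dist_norm power2_less_imp_less)
    qed
    then show "\<exists>M. \<forall>m\<ge>M. \<forall>n\<ge>M. dist (X m) (X n) < e" by blast
  qed
  then obtain w where w: "X \<longlonglongrightarrow> w" using Cauchy_convergent convergent_def by blast
  have "(\<lambda>n. J (X n)) \<longlonglongrightarrow> J w"
    unfolding J_def by (intro tendsto_intros w \<phi>.tendsto)
  moreover have "(\<lambda>n. I + inverse (real (Suc n))) \<longlonglongrightarrow> I + 0"
    by (intro tendsto_intros LIMSEQ_inverse_real_of_nat)
  ultimately have Jw: "J w \<le> I"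
    using X by (intro LIMSEQ_le[of "\<lambda>n. J (X n)"]) (auto intro: less_imp_le)
  have "\<phi> y = re_inner y w" for y
  proof -
    have "0 \<le> 0 + 2 * (re_inner w y - \<phi> y) * t + (norm y)\<^sup>2 * t\<^sup>2" for t
    proof -
      have "J (w + t *\<^sub>R y) = J w + 2 * (re_inner w y - \<phi> y) * t + (norm y)\<^sup>2 * t\<^sup>2"
        by (simp add: J_def norm_add_squared \<phi>.add \<phi>.scaleR re_inner_scaleR_right
            power_mult_distrib algebra_simps)
      then show ?thesis using I_le[of "w + t *\<^sub>R y"] Jw by linarith
    qed
    from nonneg_quadratic_discriminant[OF this] show ?thesis
      by (simp add: re_inner_commute)
  qed
  then show ?thesis by blast
qed

lemma bounded_opsD: "A \<in> bounded_ops \<Longrightarrow> blinfun_apply A (c *\<^sub>C x) = c *\<^sub>C blinfun_apply A x"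
  by (simp add: bounded_ops_def)

text \<open>
  Since \<open>A\<close> is complex-linear, replacing \<open>x\<close> by \<open>\<i> x\<close> recovers the imaginary parts from the real ones.
  This is why adjoints, self-adjointness and positivity can all be handled with the real
  inner product.
\<close>

lemma re_inner_adjoint_imp_cinner:
  assumes "A \<in> bounded_ops"
    and re: "\<And>x y. re_inner (blinfun_apply A x) y = re_inner x (g y)"
  shows "cinner (blinfun_apply A x) y = cinner x (g y)"
proof (rule complex_eqI)
  show "Re (cinner (blinfun_apply A x) y) = Re (cinner x (g y))"
    using re by (simp add: re_inner_def)
  show "Im (cinner (blinfun_apply A x) y) = Im (cinner x (g y))"
    using re[of "\<i> *\<^sub>C x" y] by (simp add: re_inner_def bounded_opsD[OF assms(1)] cinner_scaleC_left)
qed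

lemma adjoint_exists:
  assumes A: "A \<in> bounded_ops"
  shows "\<exists>B\<in>bounded_ops. \<forall>x y. cinner (blinfun_apply A x) y = cinner x (blinfun_apply B y)"
proof -
  have "\<exists>w. \<forall>x. re_inner (blinfun_apply A x) y = re_inner x w" for y
    by (rule riesz_representation)
      (intro bounded_linear_compose[OF bounded_bilinear.bounded_linear_left[OF bounded_bilinear_re_inner]]
        blinfun.bounded_linear_right)
  then obtain b where b: "\<And>x y. re_inner (blinfun_apply A x) y = re_inner x (b y)" by metis
  have b': "cinner (blinfun_apply A x) y = cinner x (b y)" for x y
    using A b by (rule re_inner_adjoint_imp_cinner)
  have scaleC: "b (c *\<^sub>C y) = c *\<^sub>C b y" for c y
    by (rule re_inner_eqI) (simp add: re_inner_def cinner_scaleC_right flip: b')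
  have bl: "bounded_linear b"
  proof (rule bounded_linear_intro)
    show "b (x + y) = b x + b y" for x y
      by (rule re_inner_eqI) (simp add: re_inner_add_right flip: b)
    show "b (r *\<^sub>R x) = r *\<^sub>R b x" for r x
      by (simp add: scaleR_scaleC scaleC)
    show "norm (b y) \<le> norm y * norm A" for y
    proof (cases "b y = 0")
      case False
      have "(norm (b y))\<^sup>2 \<le> norm (blinfun_apply A (b y)) * norm y"
        using re_inner_bound[of "blinfun_apply A (b y)" y] b[of "b y" y] by (simp add: re_inner_self)
      also have "\<dots> \<le> norm A * norm (b y) * norm y"
        by (intro mult_right_mono norm_blinfun) simp
      finally show ?thesis using False by (simp add: power2_eq_square algebra_simps)
    qed simp
  qed
  show ?thesis
  proof (rule bexI[of _ "Blinfun b"])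
    show "Blinfun b \<in> bounded_ops"
      by (simp add: bounded_ops_def bounded_linear_Blinfun_apply[OF bl] scaleC)
  qed (simp add: bounded_linear_Blinfun_apply[OF bl] b')
qed

lemma op_adj_eqI:
  assumes "B \<in> bounded_ops"
    and "\<And>x y. cinner (blinfun_apply A x) y = cinner x (blinfun_apply B y)"
  shows "op_adj A = B"
  unfolding op_adj_def
proof (rule the_equality)
  fix B' assume "B' \<in> bounded_ops \<and> (\<forall>x y. cinner (blinfun_apply A x) y = cinner x (blinfun_apply B' y))"
  then show "B' = B"
    using assms by (intro blinfun_eqI re_inner_eqI) (simp add: re_inner_def)
qed (use assms in blast)

lemma
  assumes "A \<in> bounded_ops"
  shows op_adj_in_bounded_ops: "op_adj A \<in> bounded_ops"
    and cinner_op_adj: "cinner (blinfun_apply A x) y = cinner x (blinfun_apply (op_adj A) y)"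
  using adjoint_exists[OF assms] op_adj_eqI by metis+

lemma self_adjoint_iff:
  "self_adjoint X \<longleftrightarrow> X \<in> bounded_ops \<and>
     (\<forall>x y. re_inner (blinfun_apply X x) y = re_inner x (blinfun_apply X y))"
proof
  assume "self_adjoint X"
  then show "X \<in> bounded_ops \<and> (\<forall>x y. re_inner (blinfun_apply X x) y = re_inner x (blinfun_apply X y))"
    using cinner_op_adj[of X] by (simp add: self_adjoint_def re_inner_def)
next
  assume *: "X \<in> bounded_ops \<and> (\<forall>x y. re_inner (blinfun_apply X x) y = re_inner x (blinfun_apply X y))"
  then have "op_adj X = X"
    by (intro op_adj_eqI re_inner_adjoint_imp_cinner) auto
  with * show "self_adjoint X" by (simp add: self_adjoint_def)
qed

lemma self_adjointD:
  "self_adjoint X \<Longrightarrow> re_inner (blinfun_apply X x) y = re_inner x (blinfun_apply X y)"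
  by (simp add: self_adjoint_iff)

section \<open>Algebra and limits of complex-linear and self-adjoint operators\<close>

lemma norm_scaleC: "norm (c *\<^sub>C x) = cmod c * norm x"
proof -
  have "complex_of_real ((norm (c *\<^sub>C x))\<^sup>2) = (c * cnj c) * complex_of_real ((norm x)\<^sup>2)"
    unfolding cinner_self[symmetric] by (simp add: cinner_scaleC_left cinner_scaleC_right mult.assoc)
  also have "\<dots> = complex_of_real ((cmod c * norm x)\<^sup>2)"
    by (simp only: power_mult_distrib of_real_mult complex_norm_square)
  finally show ?thesis
    by (simp only: of_real_eq_iff) (simp add: power2_eq_iff_nonneg)
qed

lemma bounded_linear_scaleC: "bounded_linear ((*\<^sub>C) c :: 'a::chilbert_space \<Rightarrow> 'a)"
  by (rule bounded_linear_intro[where K = "cmod c"])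
    (simp_all add: scaleC_add_right norm_scaleC mult.commute scaleR_scaleC scaleC_scaleC)

text \<open>
  The operator type consists of real-linear maps and carries real scalar multiplication only, so
  a complex scalar enters as an operator of its own.
\<close>

definition scale_op :: "complex \<Rightarrow> 'a::chilbert_space \<Rightarrow>\<^sub>L 'a" where
  "scale_op c = Blinfun ((*\<^sub>C) c)"

lemma scale_op_apply [simp]: "blinfun_apply (scale_op c) x = c *\<^sub>C x"
  by (simp add: scale_op_def bounded_linear_Blinfun_apply[OF bounded_linear_scaleC])

lemma scale_op_of_real: "scale_op (complex_of_real r) = r *\<^sub>R id_blinfun"
  by (rule blinfun_eqI) (simp add: blinfun.scaleR_left scaleR_scaleC)

lemma scaleC_one: "1 *\<^sub>C x = x"
  using scaleR_scaleC[of 1 x] by simp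

lemma scaleC_diff_right: "c *\<^sub>C (x - y) = c *\<^sub>C x - c *\<^sub>C y"
  using scaleC_add_right[of c "x - y" y] by simp

lemma bounded_ops_intros:
  assumes "A \<in> bounded_ops" "B \<in> bounded_ops"
  shows "A + B \<in> bounded_ops" "A - B \<in> bounded_ops" "A o\<^sub>L B \<in> bounded_ops"
  using assms
  by (simp_all add: bounded_ops_def blinfun.add_left blinfun.diff_left blinfun.scaleR_left
      scaleC_add_right scaleC_diff_right scaleR_scaleC scaleC_scaleC mult.commute)

lemma scaleR_in_bounded_ops: "A \<in> bounded_ops \<Longrightarrow> r *\<^sub>R A \<in> bounded_ops"
  by (simp add: bounded_ops_def blinfun.scaleR_left scaleR_scaleC scaleC_scaleC mult.commute)

lemma scale_op_in_bounded_ops: "scale_op c \<in> bounded_ops"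
  by (simp add: bounded_ops_def scaleC_scaleC mult.commute)

lemma id_in_bounded_ops: "id_blinfun \<in> bounded_ops"
  by (simp add: bounded_ops_def)

lemma self_adjoint_add: "self_adjoint A \<Longrightarrow> self_adjoint B \<Longrightarrow> self_adjoint (A + B)"
  by (simp add: self_adjoint_iff bounded_ops_intros blinfun.add_left re_inner_add_left re_inner_add_right)

lemma self_adjoint_diff: "self_adjoint A \<Longrightarrow> self_adjoint B \<Longrightarrow> self_adjoint (A - B)"
  by (simp add: self_adjoint_iff bounded_ops_intros blinfun.diff_left re_inner_diff_left re_inner_diff_right)

lemma self_adjoint_scaleR: "self_adjoint A \<Longrightarrow> self_adjoint (r *\<^sub>R A)"
  by (simp add: self_adjoint_iff scaleR_in_bounded_ops blinfun.scaleR_left re_inner_scaleR_left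
      re_inner_scaleR_right)

lemma self_adjoint_id: "self_adjoint id_blinfun"
  by (simp add: self_adjoint_iff id_in_bounded_ops)

lemma self_adjoint_limit:
  assumes lim: "X \<longlonglongrightarrow> L" and sa: "\<And>n. self_adjoint (X n)"
  shows "self_adjoint L"
  unfolding self_adjoint_iff
proof (intro conjI allI)
  have lim': "(\<lambda>n. blinfun_apply (X n) x) \<longlonglongrightarrow> blinfun_apply L x" for x
    by (intro blinfun.tendsto lim tendsto_const)
  show "L \<in> bounded_ops"
    unfolding bounded_ops_def
  proof (clarify)
    fix c x
    have "(\<lambda>n. c *\<^sub>C blinfun_apply (X n) x) \<longlonglongrightarrow> c *\<^sub>C blinfun_apply L x"
      by (intro bounded_linear.tendsto[OF bounded_linear_scaleC] lim')
    moreover have "(\<lambda>n. c *\<^sub>C blinfun_apply (X n) x) = (\<lambda>n. blinfun_apply (X n) (c *\<^sub>C x))"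
      using sa by (simp add: self_adjoint_iff bounded_ops_def)
    ultimately show "blinfun_apply L (c *\<^sub>C x) = c *\<^sub>C blinfun_apply L x"
      using lim' LIMSEQ_unique by metis
  qed
  fix x y
  have "(\<lambda>n. re_inner (blinfun_apply (X n) x) y) \<longlonglongrightarrow> re_inner (blinfun_apply L x) y"
    by (intro bounded_bilinear.tendsto[OF bounded_bilinear_re_inner] lim' tendsto_const)
  moreover have "(\<lambda>n. re_inner x (blinfun_apply (X n) y)) \<longlonglongrightarrow> re_inner x (blinfun_apply L y)"
    by (intro bounded_bilinear.tendsto[OF bounded_bilinear_re_inner] lim' tendsto_const)
  ultimately show "re_inner (blinfun_apply L x) y = re_inner x (blinfun_apply L y)"
    using LIMSEQ_unique sa by (simp add: self_adjointD)
qed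

section \<open>Coercive operators and the spectrum\<close>

definition invertible_op :: "('a::chilbert_space \<Rightarrow>\<^sub>L 'a) \<Rightarrow> bool" where
  "invertible_op T \<longleftrightarrow> (\<exists>B\<in>bounded_ops. B o\<^sub>L T = id_blinfun \<and> T o\<^sub>L B = id_blinfun)"

lemma blinfun_eq_iff: "A = B \<longleftrightarrow> (\<forall>x. blinfun_apply A x = blinfun_apply B x)"
  by (auto intro: blinfun_eqI)

lemma spectrum_iff: "c \<in> spectrum X \<longleftrightarrow> \<not> invertible_op (X - scale_op c)"
  by (auto simp: spectrum_def invertible_op_def blinfun_eq_iff blinfun.diff_left)

lemma real_spectrum_iff:
  "complex_of_real s \<in> spectrum X \<longleftrightarrow> \<not> invertible_op (X - s *\<^sub>R id_blinfun)"
  by (simp add: spectrum_iff scale_op_of_real)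

lemma invertible_op_compose:
  assumes "invertible_op S" "invertible_op T"
  shows "invertible_op (S o\<^sub>L T)"
proof -
  obtain B C where "B \<in> bounded_ops" "B o\<^sub>L S = id_blinfun" "S o\<^sub>L B = id_blinfun"
      "C \<in> bounded_ops" "C o\<^sub>L T = id_blinfun" "T o\<^sub>L C = id_blinfun"
    using assms unfolding invertible_op_def by blast
  then show ?thesis
    unfolding invertible_op_def
    by (intro bexI[of _ "C o\<^sub>L B"] bounded_ops_intros) (simp_all add: blinfun_eq_iff)
qed

lemma invertible_scale_op:
  assumes "c \<noteq> 0"
  shows "invertible_op (scale_op c)"
  unfolding invertible_op_def
proof (rule bexI[of _ "scale_op (1 / c)"])
  show "scale_op (1 / c) o\<^sub>L scale_op c = (id_blinfun :: 'a \<Rightarrow>\<^sub>L 'a) \<and>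
    scale_op c o\<^sub>L scale_op (1 / c) = (id_blinfun :: 'a \<Rightarrow>\<^sub>L 'a)"
    using assms by (simp add: blinfun_eq_iff scaleC_scaleC scaleC_one)
qed (rule scale_op_in_bounded_ops)

text \<open>
  A form of the Lax--Milgram lemma. For a small step \<open>e\<close> the map \<open>x \<mapsto> x - e (T x - y)\<close>
  is a contraction, and its fixed point solves \<open>T x = y\<close>; coercivity bounds the inverse by \<open>1 / k\<close>.
\<close>

lemma coercive_invertible:
  fixes T :: "'a::chilbert_space \<Rightarrow>\<^sub>L 'a"
  assumes T: "T \<in> bounded_ops" and k: "k > 0"
    and coercive: "\<And>x. k * (norm x)\<^sup>2 \<le> re_inner (blinfun_apply T x) x"
  shows "invertible_op T"
proof -
  have below: "k * norm x \<le> norm (blinfun_apply T x)" for x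
  proof (cases "x = 0")
    case False
    have "k * (norm x)\<^sup>2 \<le> norm (blinfun_apply T x) * norm x"
      using coercive[of x] re_inner_bound[of "blinfun_apply T x" x] by linarith
    then show ?thesis using False by (simp add: power2_eq_square flip: mult.assoc)
  qed simp
  define M where "M = norm T + k"
  have M: "M > 0" "k \<le> M" "norm T \<le> M" using k by (auto simp: M_def add_nonneg_pos)
  \<comment> \<open>The step minimises the contraction bound \<open>1 - 2 e k + e\<^sup>2 M\<^sup>2\<close>.
    The summand \<open>k\<close> in \<open>M\<close> makes \<open>M\<close> positive and keeps \<open>k / M\<close> at most 1.\<close>
  define e where "e = k / M\<^sup>2"
  define q where "q = sqrt (1 - (k / M)\<^sup>2)"
  have kM: "0 < k / M" "k / M \<le> 1" using M k by simp_all
  have q: "0 \<le> q" "q < 1" "q\<^sup>2 = 1 - (k / M)\<^sup>2"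
  proof -
    have "(k / M)\<^sup>2 \<le> 1" using kM by (intro power_le_one) auto
    moreover have "0 < (k / M)\<^sup>2" using kM by (intro zero_less_power)
    ultimately show "0 \<le> q" "q < 1" "q\<^sup>2 = 1 - (k / M)\<^sup>2"
      unfolding q_def by (simp_all only: real_sqrt_ge_0_iff real_sqrt_lt_1_iff real_sqrt_pow2_iff)
  qed
  have contr: "norm (x - e *\<^sub>R blinfun_apply T x) \<le> q * norm x" for x
  proof -
    have "(norm (x - e *\<^sub>R blinfun_apply T x))\<^sup>2
        = (norm x)\<^sup>2 - 2 * e * re_inner (blinfun_apply T x) x + e\<^sup>2 * (norm (blinfun_apply T x))\<^sup>2"
      by (simp add: norm_diff_squared re_inner_scaleR_right power_mult_distrib re_inner_commute)
    also have "\<dots> \<le> (norm x)\<^sup>2 - 2 * e * (k * (norm x)\<^sup>2) + e\<^sup>2 * (M * norm x)\<^sup>2"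
    proof -
      have "norm (blinfun_apply T x) \<le> M * norm x"
        using norm_blinfun[of T x] mult_right_mono[OF M(3) norm_ge_zero[of x]] by linarith
      then show ?thesis
        using coercive[of x] k M
        by (intro add_mono diff_mono mult_left_mono power_mono) (auto simp: e_def)
    qed
    also have "\<dots> = (q * norm x)\<^sup>2"
    proof -
      have "e * k = (k / M)\<^sup>2" "e\<^sup>2 * M\<^sup>2 = (k / M)\<^sup>2"
        using M by (simp_all add: e_def power2_eq_square)
      then show ?thesis
        unfolding power_mult_distrib q(3) by (simp add: left_diff_distrib flip: mult.assoc)
    qed
    finally show ?thesis by (rule power2_le_imp_le) (simp add: q(1))
  qed
  have e: "e > 0" using M k by (simp add: e_def)
  have surj: "\<exists>x. blinfun_apply T x = y" for y
  proof -
    let ?F = "\<lambda>x. x - e *\<^sub>R blinfun_apply T x + e *\<^sub>R y"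
    have "dist (?F x) (?F z) \<le> q * dist x z" for x z
      using contr[of "x - z"] by (simp add: dist_norm blinfun.diff_right algebra_simps)
    then have "\<exists>!x. ?F x = x" using q(1,2) by (intro banach_fix_type[of q]) auto
    then obtain x where "?F x = x" by blast
    then have "e *\<^sub>R (y - blinfun_apply T x) = 0" by (simp add: algebra_simps)
    then show ?thesis using e by auto
  qed
  have inj: "blinfun_apply T x = blinfun_apply T y \<Longrightarrow> x = y" for x y
  proof -
    assume "blinfun_apply T x = blinfun_apply T y"
    then have "k * norm (x - y) \<le> 0" using below[of "x - y"] by (simp add: blinfun.diff_right)
    then show "x = y" using k by (simp add: mult_le_0_iff)
  qed
  from surj obtain g where g: "\<And>y. blinfun_apply T (g y) = y" by metis
  have bl: "bounded_linear g"
  proof (rule bounded_linear_intro)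
    show "g (x + y) = g x + g y" for x y by (rule inj) (simp add: g blinfun.add_right)
    show "g (r *\<^sub>R x) = r *\<^sub>R g x" for r x by (rule inj) (simp add: g blinfun.scaleR_right)
    show "norm (g y) \<le> norm y * (1 / k)" for y using below[of "g y"] k by (simp add: g field_simps)
  qed
  have gT: "g (blinfun_apply T x) = x" for x by (rule inj) (simp add: g)
  show ?thesis
    unfolding invertible_op_def
  proof (rule bexI[of _ "Blinfun g"])
    show "Blinfun g o\<^sub>L T = id_blinfun \<and> T o\<^sub>L Blinfun g = id_blinfun"
      by (simp add: blinfun_eq_iff bounded_linear_Blinfun_apply[OF bl] g gT)
    have "g (c *\<^sub>C x) = c *\<^sub>C g x" for c x
      by (rule inj) (simp add: g bounded_opsD[OF T])
    then show "Blinfun g \<in> bounded_ops"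
      by (simp add: bounded_ops_def bounded_linear_Blinfun_apply[OF bl])
  qed
qed

text \<open>
  The factor \<open>u\<close> turns the quadratic form of \<open>X - c\<close> into a half-plane away from the origin. One
  criterion thus excludes nonreal numbers (\<open>u = \<plusminus>\<i>\<close>), numbers below the form (\<open>u = 1\<close>) and
  numbers above it (\<open>u = -1\<close>).
\<close>

lemma not_in_spectrumI:
  fixes X :: "'a::chilbert_space \<Rightarrow>\<^sub>L 'a" and c u :: complex
  assumes X: "X \<in> bounded_ops" and k: "k > 0" and u: "u \<noteq> 0"
    and coercive: "\<And>x. k * (norm x)\<^sup>2 \<le> Re (u * (cinner (blinfun_apply X x) x - c * (norm x)\<^sup>2))"
  shows "c \<notin> spectrum X"
proof -
  let ?T = "X - scale_op c"
  have "invertible_op (scale_op u o\<^sub>L ?T)"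
  proof (rule coercive_invertible[OF _ k])
    fix x
    have "cinner (blinfun_apply X x - c *\<^sub>C x) x = cinner (blinfun_apply X x) x - c * (norm x)\<^sup>2"
      using cinner_add_left[of "blinfun_apply X x - c *\<^sub>C x" "c *\<^sub>C x" x]
      by (simp add: cinner_scaleC_left cinner_self)
    then show "k * (norm x)\<^sup>2 \<le> re_inner (blinfun_apply (scale_op u o\<^sub>L ?T) x) x"
      using coercive[of x] by (simp add: re_inner_def cinner_scaleC_left blinfun.diff_left)
  qed (intro bounded_ops_intros scale_op_in_bounded_ops X)
  then have "invertible_op (scale_op (1 / u) o\<^sub>L (scale_op u o\<^sub>L ?T))"
    by (rule invertible_op_compose[OF invertible_scale_op, rotated]) (use u in simp)
  moreover have "scale_op (1 / u) o\<^sub>L (scale_op u o\<^sub>L ?T) = ?T"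
    using u by (simp add: blinfun_eq_iff scaleC_scaleC scaleC_one)
  ultimately show ?thesis by (simp only: spectrum_iff not_not)
qed

lemma self_adjoint_quadratic_form_real:
  assumes "self_adjoint X"
  shows "cinner (blinfun_apply X x) x = complex_of_real (re_inner (blinfun_apply X x) x)"
proof -
  have "cinner (blinfun_apply X x) x = cnj (cinner (blinfun_apply X x) x)"
    using cinner_op_adj[of X x x] assms
    by (subst cinner_commute) (simp add: self_adjoint_def)
  then show ?thesis by (simp add: re_inner_def complex_eq_iff)
qed

text \<open>
  Polarisation: the form is real at \<open>x + \<i> y\<close>, and its imaginary part there is the
  difference of the two sides of the symmetry condition.
\<close>

lemma positive_op_imp_self_adjoint:
  assumes "positive_op X"
  shows "self_adjoint X"
  unfolding self_adjoint_iff
proof (intro conjI allI)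
  show X: "X \<in> bounded_ops" using assms by (simp add: positive_op_def)
  fix x y
  have im: "Im (cinner (blinfun_apply X z) z) = 0" for z using assms by (simp add: positive_op_def)
  have "Im (cinner (blinfun_apply X (x + \<i> *\<^sub>C y)) (x + \<i> *\<^sub>C y))
      = re_inner (blinfun_apply X y) x - re_inner (blinfun_apply X x) y"
    using im[of x] im[of y]
    by (simp add: blinfun.add_right bounded_opsD[OF X] cinner_add_left re_inner_def
        cinner_scaleC_left cinner_scaleC_right cinner_add_right)
  then show "re_inner (blinfun_apply X x) y = re_inner x (blinfun_apply X y)"
    using im[of "x + \<i> *\<^sub>C y"] by (simp add: re_inner_commute)
qed

lemma positive_op_iff:
  "positive_op X \<longleftrightarrow> self_adjoint X \<and> (\<forall>x. 0 \<le> re_inner (blinfun_apply X x) x)"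
proof
  assume "positive_op X"
  then show "self_adjoint X \<and> (\<forall>x. 0 \<le> re_inner (blinfun_apply X x) x)"
    by (simp add: positive_op_imp_self_adjoint) (simp add: positive_op_def re_inner_def)
next
  assume "self_adjoint X \<and> (\<forall>x. 0 \<le> re_inner (blinfun_apply X x) x)"
  then show "positive_op X"
    by (simp add: positive_op_def self_adjoint_quadratic_form_real self_adjoint_def)
qed

lemma spectrum_self_adjoint_real:
  assumes X: "self_adjoint X" and c: "c \<in> spectrum X"
  shows "Im c = 0"
proof (rule ccontr)
  assume im: "Im c \<noteq> 0"
  have "c \<notin> spectrum X"
  proof (rule not_in_spectrumI)
    show "X \<in> bounded_ops" using X by (simp add: self_adjoint_def)
    show "\<bar>Im c\<bar> > 0" "complex_of_real (sgn (Im c)) * \<i> \<noteq> 0" using im by (simp_all add: sgn_eq_0_iff)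
    fix x
    show "\<bar>Im c\<bar> * (norm x)\<^sup>2
        \<le> Re (complex_of_real (sgn (Im c)) * \<i> * (cinner (blinfun_apply X x) x - c * (norm x)\<^sup>2))"
      by (simp add: self_adjoint_quadratic_form_real[OF X] abs_sgn)
  qed
  with c show False by simp
qed

lemma quadratic_form_le_norm:
  "re_inner (blinfun_apply X x) x \<le> norm X * (norm x)\<^sup>2"
  using re_inner_bound[of "blinfun_apply X x" x]
    mult_right_mono[OF norm_blinfun[of X x] norm_ge_zero[of x]]
  by (simp add: power2_eq_square)

lemma spectrum_positive_op:
  assumes X: "positive_op X"
  shows "spectrum X \<subseteq> complex_of_real ` {0..norm X}"
proof
  fix c assume c: "c \<in> spectrum X"
  have sa: "self_adjoint X" using X by (simp add: positive_op_iff)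
  have X': "X \<in> bounded_ops" using sa by (simp add: self_adjoint_def)
  define s where "s = Re c"
  have cs: "c = complex_of_real s"
    using spectrum_self_adjoint_real[OF sa c] by (simp add: s_def complex_eq_iff)
  have "0 \<le> s"
  proof (rule ccontr)
    assume "\<not> 0 \<le> s"
    then have "c \<notin> spectrum X"
      using X by (intro not_in_spectrumI[where k = "- s" and u = 1, OF X'])
        (auto simp: self_adjoint_quadratic_form_real[OF sa] cs positive_op_iff)
    with c show False by simp
  qed
  moreover have "s \<le> norm X"
  proof (rule ccontr)
    assume "\<not> s \<le> norm X"
    then have "c \<notin> spectrum X"
      using quadratic_form_le_norm[of X]
      by (intro not_in_spectrumI[where k = "s - norm X" and u = "-1", OF X'])
        (auto simp: self_adjoint_quadratic_form_real[OF sa] cs left_diff_distrib)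
    with c show False by simp
  qed
  ultimately show "c \<in> complex_of_real ` {0..norm X}" using cs by auto
qed

section \<open>Polynomials of an operator\<close>

lemma poly_op_altdef:
  assumes "degree p \<le> n"
  shows "poly_op p X = (\<Sum>i\<le>n. coeff p i *\<^sub>R (((o\<^sub>L) X ^^ i) id_blinfun))"
  unfolding poly_op_def
  by (rule sum.mono_neutral_left) (use assms in \<open>auto simp: coeff_eq_0\<close>)

lemma poly_op_pCons:
  "poly_op (pCons a p) X = a *\<^sub>R id_blinfun + (X o\<^sub>L poly_op p X)"
proof -
  have "poly_op (pCons a p) X
      = (\<Sum>i\<le>Suc (degree p). coeff (pCons a p) i *\<^sub>R (((o\<^sub>L) X ^^ i) id_blinfun))"
    by (rule poly_op_altdef) (rule degree_pCons_le)
  also have "\<dots> = a *\<^sub>R id_blinfun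
      + (\<Sum>i\<le>degree p. X o\<^sub>L (coeff p i *\<^sub>R (((o\<^sub>L) X ^^ i) id_blinfun)))"
    by (subst sum.atMost_Suc_shift)
      (simp add: bounded_bilinear.scaleR_right[OF bounded_bilinear_blinfun_compose])
  also have "\<dots> = a *\<^sub>R id_blinfun + (X o\<^sub>L poly_op p X)"
    unfolding poly_op_def by (simp add: bounded_bilinear.sum_right[OF bounded_bilinear_blinfun_compose])
  finally show ?thesis .
qed

lemma poly_op_0 [simp]: "poly_op 0 X = 0"
  by (simp add: poly_op_def)

lemma poly_op_const [simp]: "poly_op [:a:] X = a *\<^sub>R id_blinfun"
  by (simp add: poly_op_pCons bounded_bilinear.zero_right[OF bounded_bilinear_blinfun_compose])

lemma poly_op_add: "poly_op (p + q) X = poly_op p X + poly_op q X"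
proof (induction p q rule: poly_induct2)
  case (pCons a p b q)
  then show ?case
    by (simp add: poly_op_pCons bounded_bilinear.add_right[OF bounded_bilinear_blinfun_compose]
        scaleR_add_left)
qed simp

lemma poly_op_smult: "poly_op (smult c p) X = c *\<^sub>R poly_op p X"
  by (induction p)
    (simp_all add: poly_op_pCons bounded_bilinear.scaleR_right[OF bounded_bilinear_blinfun_compose]
      scaleR_add_right)

lemma poly_op_diff: "poly_op (p - q) X = poly_op p X - poly_op q X"
  using poly_op_add[of "p - q" q X] by simp

lemma poly_op_mult: "poly_op (p * q) X = poly_op p X o\<^sub>L poly_op q X"
proof (induction p)
  case 0
  show ?case by (simp add: bounded_bilinear.zero_left[OF bounded_bilinear_blinfun_compose])
next
  case (pCons a p)
  then show ?case
    by (simp add: poly_op_add poly_op_smult poly_op_pCons blinfun_eq_iff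
        blinfun.add_left blinfun.scaleR_left)
qed

lemma poly_op_X: "poly_op [:0, 1:] X = X"
  by (simp add: poly_op_pCons blinfun_eq_iff blinfun.add_left)

lemma poly_op_commute: "poly_op p X o\<^sub>L X = X o\<^sub>L poly_op p X"
  by (metis poly_op_X poly_op_mult mult.commute)

lemma self_adjoint_poly_op:
  assumes X: "self_adjoint X"
  shows "self_adjoint (poly_op p X)"
proof (induction p)
  case 0
  show ?case using self_adjoint_scaleR[OF self_adjoint_id, of 0] by simp
next
  case (pCons a p)
  have "self_adjoint (X o\<^sub>L poly_op p X)"
    unfolding self_adjoint_iff
  proof (intro conjI allI)
    show "X o\<^sub>L poly_op p X \<in> bounded_ops"
      using X pCons by (intro bounded_ops_intros) (simp_all add: self_adjoint_def)
    fix x y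
    have "re_inner (blinfun_apply (X o\<^sub>L poly_op p X) x) y
        = re_inner x (blinfun_apply (poly_op p X o\<^sub>L X) y)"
      using X pCons by (simp add: self_adjointD)
    then show "re_inner (blinfun_apply (X o\<^sub>L poly_op p X) x) y
        = re_inner x (blinfun_apply (X o\<^sub>L poly_op p X) y)"
      by (simp only: poly_op_commute)
  qed
  then show ?case
    by (simp add: poly_op_pCons self_adjoint_add self_adjoint_scaleR self_adjoint_id)
qed

text \<open>
  The quadratic is the minimal polynomial of \<open>z\<close> over the reals: the remainder of \<open>q\<close> modulo it has
  degree at most one and vanishes at the nonreal \<open>z\<close>, so it is zero.
\<close>

lemma real_quadratic_factor:
  fixes q :: "real poly"
  assumes root: "poly (map_poly complex_of_real q) z = 0" and nonreal: "Im z \<noteq> 0"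
  shows "[:(cmod z)\<^sup>2, - 2 * Re z, 1:] dvd q"
proof -
  let ?d = "[:(cmod z)\<^sup>2, - 2 * Re z, 1:]"
  define E where "E p = poly (map_poly complex_of_real p) z" for p
  have E_pCons: "E (pCons a p) = complex_of_real a + z * E p" for a p
    by (simp add: E_def map_poly_pCons)
  have E_0: "E 0 = 0" by (simp add: E_def)
  have E_add: "E (p + r) = E p + E r" for p r
    by (induction p r rule: poly_induct2) (simp_all add: E_pCons E_0 algebra_simps)
  have E_smult: "E (smult c p) = complex_of_real c * E p" for c p
    by (induction p) (simp_all add: E_pCons E_0 algebra_simps)
  have E_mult: "E (p * r) = E p * E r" for p r
    by (induction p) (simp_all add: E_pCons E_0 E_add E_smult algebra_simps)
  have E_d: "E ?d = 0"
    by (simp add: E_pCons E_0 complex_eq_iff cmod_power2) (simp add: power2_eq_square algebra_simps)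
  have "E q = E (q div ?d * ?d + q mod ?d)" by (simp only: div_mult_mod_eq)
  then have E_mod: "E (q mod ?d) = 0" using root E_d by (simp only: E_add E_mult) (simp add: E_def)
  have "degree (q mod ?d) \<le> 1"
    using degree_mod_less[of ?d q] by auto
  then obtain a b where ab: "q mod ?d = [:a, b:]"
  proof -
    obtain a r where ar: "q mod ?d = pCons a r" by (cases "q mod ?d") auto
    with \<open>degree (q mod ?d) \<le> 1\<close> have "degree r = 0" by (auto split: if_splits)
    then show thesis using ar that by (metis degree_eq_zeroE)
  qed
  have "complex_of_real a + z * complex_of_real b = 0" using E_mod unfolding ab by (simp add: E_pCons E_0)
  then have "a + Re z * b = 0" "Im z * b = 0" by (simp_all add: complex_eq_iff)
  with nonreal have "a = 0" "b = 0" by simp_all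
  with ab show ?thesis by (simp add: mod_eq_0_iff_dvd)
qed

text \<open>
  One half of the spectral mapping theorem, by induction along the factorisation of \<open>q\<close> over the
  reals. A linear factor \<open>X - s\<close> is invertible as \<open>s\<close> lies outside the spectrum; a quadratic factor
  without real roots is \<open>(X - a)\<^sup>2 + b\<^sup>2\<close> with \<open>b \<noteq> 0\<close>, which is coercive.
\<close>

lemma invertible_poly_op:
  assumes X: "self_adjoint X" and "q \<noteq> 0"
    and "\<And>s. complex_of_real s \<in> spectrum X \<Longrightarrow> poly q s \<noteq> 0"
  shows "invertible_op (poly_op q X)"
  using assms(2,3)
proof (induction "degree q" arbitrary: q rule: less_induct)
  case less
  have X': "X \<in> bounded_ops" using X by (simp add: self_adjoint_def)
  have factor: "invertible_op (poly_op q X)"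
    if "degree d > 0" "d dvd q" "invertible_op (poly_op d X)" for d
  proof -
    from \<open>d dvd q\<close> obtain r where r: "q = d * r" by (elim dvdE)
    with less.prems(1) have nz: "d \<noteq> 0" "r \<noteq> 0" by auto
    have "invertible_op (poly_op r X)"
    proof (rule less.hyps)
      show "degree r < degree q" using r nz that(1) by (simp add: degree_mult_eq)
      show "\<And>s. complex_of_real s \<in> spectrum X \<Longrightarrow> poly r s \<noteq> 0"
        using less.prems(2) r by fastforce
    qed (rule nz)
    then show ?thesis using r that(3) by (simp add: poly_op_mult invertible_op_compose)
  qed
  show ?case
  proof (cases "degree q = 0")
    case True
    then obtain a where a: "q = [:a:]" by (metis degree_eq_zeroE)
    with less.prems(1) have "a \<noteq> 0" by simp
    then show ?thesis
      using invertible_scale_op[of "complex_of_real a"] by (simp add: a scale_op_of_real)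
  next
    case False
    let ?Q = "map_poly complex_of_real q"
    have "\<not> constant (poly ?Q)" using False by (simp add: constant_degree degree_map_poly)
    then obtain z where z: "poly ?Q z = 0" using fundamental_theorem_of_algebra by blast
    show ?thesis
    proof (cases "Im z = 0")
      case True
      then have "z = complex_of_real (Re z)" by (simp add: complex_eq_iff)
      have "poly (map_poly complex_of_real p) (complex_of_real s) = complex_of_real (poly p s)" for p s
        by (induction p) (simp_all add: map_poly_pCons)
      with z \<open>z = complex_of_real (Re z)\<close> have root: "poly q (Re z) = 0"
        by (metis of_real_eq_0_iff)
      show ?thesis
      proof (rule factor)
        show "[:- Re z, 1:] dvd q" using root by (simp add: poly_eq_0_iff_dvd)
        have "complex_of_real (Re z) \<notin> spectrum X" using root less.prems(2) by blast
        then show "invertible_op (poly_op [:- Re z, 1:] X)"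
          using poly_op_diff[of "[:0, 1:]" "[:Re z:]" X] by (simp add: real_spectrum_iff poly_op_X)
      qed simp
    next
      case False
      let ?d = "[:(cmod z)\<^sup>2, - 2 * Re z, 1:]"
      show ?thesis
      proof (rule factor)
        show "?d dvd q" using z False by (rule real_quadratic_factor)
        show "invertible_op (poly_op ?d X)"
        proof (rule coercive_invertible)
          show "poly_op ?d X \<in> bounded_ops"
            using self_adjoint_poly_op[OF X] by (simp add: self_adjoint_def)
          show "(Im z)\<^sup>2 > 0" using False by simp
          fix x
          have "re_inner (blinfun_apply (poly_op ?d X) x) x
              = (norm (blinfun_apply X x - Re z *\<^sub>R x))\<^sup>2 + (Im z)\<^sup>2 * (norm x)\<^sup>2"
            unfolding norm_diff_squared poly_op_pCons poly_op_0 cmod_power2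
            by (simp add: blinfun.add_left blinfun.add_right blinfun.scaleR_left blinfun.scaleR_right
                blinfun.diff_left blinfun.diff_right
                re_inner_add_left re_inner_scaleR_left re_inner_scaleR_right re_inner_diff_left
                self_adjointD[OF X, of "blinfun_apply X x"] re_inner_self power_mult_distrib
                bounded_bilinear.zero_right[OF bounded_bilinear_blinfun_compose] algebra_simps)
          then show "(Im z)\<^sup>2 * (norm x)\<^sup>2 \<le> re_inner (blinfun_apply (poly_op ?d X) x) x" by simp
        qed
      qed simp
    qed
  qed
qed

section \<open>Norm and spectrum of positive operators\<close>

lemma positive_form_cauchy_schwarz:
  assumes "positive_op Z"
  shows "(re_inner (blinfun_apply Z x) y)\<^sup>2
    \<le> re_inner (blinfun_apply Z x) x * re_inner (blinfun_apply Z y) y"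
proof (rule nonneg_quadratic_discriminant)
  fix t
  have Z: "self_adjoint Z" and nonneg: "\<And>x. 0 \<le> re_inner (blinfun_apply Z x) x"
    using assms by (simp_all add: positive_op_iff)
  have "re_inner (blinfun_apply Z y) x = re_inner (blinfun_apply Z x) y"
    using self_adjointD[OF Z, of x y] by (simp add: re_inner_commute)
  then have "re_inner (blinfun_apply Z (x + t *\<^sub>R y)) (x + t *\<^sub>R y)
      = re_inner (blinfun_apply Z x) x + 2 * re_inner (blinfun_apply Z x) y * t
        + re_inner (blinfun_apply Z y) y * t\<^sup>2"
    by (simp add: blinfun.add_right blinfun.scaleR_right re_inner_add_left re_inner_add_right
        re_inner_scaleR_left re_inner_scaleR_right power2_eq_square algebra_simps)
  then show "0 \<le> re_inner (blinfun_apply Z x) x + 2 * re_inner (blinfun_apply Z x) y * t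
      + re_inner (blinfun_apply Z y) y * t\<^sup>2"
    using nonneg by metis
qed

text \<open>
  Cauchy--Schwarz for the form of \<open>Z\<close>, applied to \<open>x\<close> and \<open>Z x\<close>. The quadratic form thereby
  controls the operator itself, and this gives both the monotonicity of the norm and the
  spectral point at the bottom of the form.
\<close>

lemma positive_op_norm_squared_le:
  assumes Z: "positive_op Z"
  shows "(norm (blinfun_apply Z x))\<^sup>2 \<le> norm Z * re_inner (blinfun_apply Z x) x"
proof (cases "blinfun_apply Z x = 0")
  case False
  let ?y = "blinfun_apply Z x"
  have nonneg: "0 \<le> re_inner (blinfun_apply Z x) x" using Z by (simp add: positive_op_iff)
  have "((norm ?y)\<^sup>2)\<^sup>2 \<le> re_inner (blinfun_apply Z x) x * re_inner (blinfun_apply Z ?y) ?y"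
    using positive_form_cauchy_schwarz[OF Z, of x ?y] by (simp add: re_inner_self)
  also have "\<dots> \<le> re_inner (blinfun_apply Z x) x * (norm Z * (norm ?y)\<^sup>2)"
    by (intro mult_left_mono quadratic_form_le_norm nonneg)
  finally have "(norm ?y)\<^sup>2 * (norm ?y)\<^sup>2 \<le> (norm Z * re_inner (blinfun_apply Z x) x) * (norm ?y)\<^sup>2"
    by (simp add: power2_eq_square algebra_simps)
  then show ?thesis using False by (simp only: mult_le_cancel_right) simp
qed (use re_inner_scaleR_left[of 0 x x] in simp)

text \<open>
  From \<open>\<parallel>S x\<parallel>\<^sup>2 \<le> \<parallel>S\<parallel> \<langle>S x, x\<rangle> \<le> \<parallel>S\<parallel> \<langle>T x, x\<rangle> \<le> \<parallel>S\<parallel> \<parallel>T\<parallel> \<parallel>x\<parallel>\<^sup>2\<close>.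
\<close>

lemma norm_mono_positive_op:
  assumes S: "positive_op S"
    and le: "\<And>x. re_inner (blinfun_apply S x) x \<le> re_inner (blinfun_apply T x) x"
  shows "norm S \<le> norm T"
proof -
  have bound: "norm (blinfun_apply S x) \<le> sqrt (norm S * norm T) * norm x" for x
  proof -
    have "(norm (blinfun_apply S x))\<^sup>2 \<le> norm S * (norm T * (norm x)\<^sup>2)"
      using positive_op_norm_squared_le[OF S, of x] le[of x] quadratic_form_le_norm[of T x]
      by (meson mult_left_mono norm_ge_zero order_trans)
    also have "\<dots> = (sqrt (norm S * norm T) * norm x)\<^sup>2"
      by (simp add: power_mult_distrib)
    finally show ?thesis by (rule power2_le_imp_le) simp
  qed
  have "norm S \<le> sqrt (norm S * norm T)"
    by (rule norm_blinfun_bound) (use bound in auto)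
  then have "(norm S)\<^sup>2 \<le> norm S * norm T"
    by (metis norm_ge_zero power_mono real_sqrt_pow2 mult_nonneg_nonneg)
  then show ?thesis
    by (cases "norm S = 0") (auto simp: power2_eq_square)
qed

text \<open>
  Let \<open>m\<close> be the infimum of the form on the unit sphere and \<open>Z = Y - m\<close>. If \<open>Z\<close> had an inverse \<open>B\<close>, then
  \<open>1 \<le> \<parallel>B\<parallel>\<^sup>2 \<parallel>Z x\<parallel>\<^sup>2 \<le> \<parallel>B\<parallel>\<^sup>2 \<parallel>Z\<parallel> \<langle>Z x, x\<rangle>\<close> on the unit sphere would keep the form of \<open>Z\<close> away
  from zero there, against the choice of \<open>m\<close>. On the zero space the spectrum is empty, hence the
  nontriviality hypothesis.
\<close>

lemma form_lower_bound_in_spectrum: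
  fixes Y :: "'a::chilbert_space \<Rightarrow>\<^sub>L 'a"
  assumes Y: "self_adjoint Y" and nontriv: "\<exists>x::'a. x \<noteq> 0"
  obtains m where "complex_of_real m \<in> spectrum Y"
    "\<And>x. m * (norm x)\<^sup>2 \<le> re_inner (blinfun_apply Y x) x"
proof -
  define R where "R = (\<lambda>x. re_inner (blinfun_apply Y x) x) ` {x. norm x = 1}"
  define m where "m = Inf R"
  obtain v :: 'a where v: "v \<noteq> 0" using nontriv by blast
  have ne: "R \<noteq> {}"
    unfolding R_def using v by (auto intro!: exI[of _ "v /\<^sub>R norm v"])
  have bdd: "bdd_below R"
  proof (rule bdd_belowI)
    fix r assume "r \<in> R"
    then obtain x where x: "norm x = 1" "r = re_inner (blinfun_apply Y x) x" by (auto simp: R_def)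
    have "\<bar>r\<bar> \<le> norm Y"
      using re_inner_bound[of "blinfun_apply Y x" x] norm_blinfun[of Y x] x by simp
    then show "- norm Y \<le> r" by simp
  qed
  have scaled: "l * (norm x)\<^sup>2 \<le> re_inner (blinfun_apply Y x) x"
    if l: "\<And>x. norm x = 1 \<Longrightarrow> l \<le> re_inner (blinfun_apply Y x) x" for l x
  proof (cases "x = 0")
    case False
    then have "l \<le> re_inner (blinfun_apply Y (x /\<^sub>R norm x)) (x /\<^sub>R norm x)" by (intro l) simp
    then show ?thesis using False
      by (simp add: blinfun.scaleR_right re_inner_scaleR_left re_inner_scaleR_right
          power2_eq_square field_simps)
  qed (simp add: re_inner_self)
  have m: "m * (norm x)\<^sup>2 \<le> re_inner (blinfun_apply Y x) x" for x
    by (rule scaled) (auto simp: m_def R_def intro!: cInf_lower bdd[unfolded R_def])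
  define Z where "Z = Y - m *\<^sub>R id_blinfun"
  have form_Z: "re_inner (blinfun_apply Z x) x = re_inner (blinfun_apply Y x) x - m * (norm x)\<^sup>2" for x
    by (simp add: Z_def blinfun.diff_left blinfun.scaleR_left re_inner_diff_left
        re_inner_scaleR_left re_inner_self)
  have Z: "positive_op Z"
    using m by (simp add: positive_op_iff form_Z)
      (simp add: Z_def self_adjoint_diff Y self_adjoint_scaleR self_adjoint_id)
  have "\<not> invertible_op Z"
  proof
    assume "invertible_op Z"
    then obtain B where "B o\<^sub>L Z = id_blinfun" by (auto simp: invertible_op_def)
    then have B: "blinfun_apply B (blinfun_apply Z x) = x" for x
      by (metis blinfun_apply_blinfun_compose id_blinfun.rep_eq id_apply)
    \<comment> \<open>The summand 1 only ensures that \<open>1 / K\<close> is a genuine positive gap.\<close>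
    define K where "K = (norm B)\<^sup>2 * norm Z + 1"
    have K: "K > 0" by (simp add: K_def add_nonneg_pos)
    have "m + 1 / K \<le> re_inner (blinfun_apply Y x) x" if x: "norm x = 1" for x
    proof -
      have "1 \<le> (norm B * norm (blinfun_apply Z x))\<^sup>2"
        using norm_blinfun[of B "blinfun_apply Z x"] x by (simp add: B)
      also have "\<dots> \<le> (norm B)\<^sup>2 * (norm Z * re_inner (blinfun_apply Z x) x)"
        unfolding power_mult_distrib by (intro mult_left_mono positive_op_norm_squared_le Z) simp
      also have "\<dots> \<le> K * re_inner (blinfun_apply Z x) x"
        using Z by (simp add: K_def positive_op_iff algebra_simps)
      finally show ?thesis using K x by (simp add: form_Z field_simps)
    qed
    then have "m + 1 / K \<le> m"
      unfolding m_def using ne by (intro cInf_greatest) (auto simp: R_def m_def)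
    then show False using K by simp
  qed
  then have "complex_of_real m \<in> spectrum Y" by (simp add: real_spectrum_iff Z_def)
  with m that show ?thesis by blast
qed

section \<open>Functional calculus on the real spectrum\<close>

abbreviation real_spectrum :: "('a::chilbert_space \<Rightarrow>\<^sub>L 'a) \<Rightarrow> real set" where
  "real_spectrum X \<equiv> {s. complex_of_real s \<in> spectrum X}"

text \<open>
  Some spectral point \<open>m\<close> of \<open>p(X)\<close> bounds the form of \<open>p(X)\<close> from below. By invertible_poly_op
  it is \<open>p(s)\<close> for some \<open>s\<close> in the real spectrum of \<open>X\<close>, hence at least \<open>c\<close>.
\<close>

lemma poly_op_form_ge:
  fixes X :: "'a::chilbert_space \<Rightarrow>\<^sub>L 'a"
  assumes X: "self_adjoint X" and c: "\<And>s. s \<in> real_spectrum X \<Longrightarrow> c \<le> poly p s"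
  shows "c * (norm x)\<^sup>2 \<le> re_inner (blinfun_apply (poly_op p X) x) x"
proof (cases "x = 0")
  case False
  then have nontriv: "\<exists>x::'a. x \<noteq> 0" by blast
  obtain m where m: "complex_of_real m \<in> spectrum (poly_op p X)"
    "\<And>x. m * (norm x)\<^sup>2 \<le> re_inner (blinfun_apply (poly_op p X) x) x"
    using form_lower_bound_in_spectrum[OF self_adjoint_poly_op[OF X] nontriv] by blast
  have ninv: "\<not> invertible_op (poly_op (p - [:m:]) X)"
    using m(1) by (simp only: real_spectrum_iff poly_op_diff poly_op_const not_False_eq_True)
  \<comment> \<open>If \<open>p\<close> is the constant \<open>m\<close>, then \<open>p - m\<close> vanishes identically, and any point of the spectrum
    of \<open>X\<close> will do; there is one because the space is not zero.\<close>
  have "c \<le> m"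
  proof (cases "p = [:m:]")
    case True
    obtain s where "s \<in> real_spectrum X"
      using form_lower_bound_in_spectrum[OF X nontriv] by blast
    then show ?thesis using c[of s] True by simp
  next
    case False
    then obtain s where "complex_of_real s \<in> spectrum X" "poly (p - [:m:]) s = 0"
      using invertible_poly_op[OF X, of "p - [:m:]"] ninv by auto
    then show ?thesis using c[of s] by simp
  qed
  then have "c * (norm x)\<^sup>2 \<le> m * (norm x)\<^sup>2" by (rule mult_right_mono) simp
  then show ?thesis using m(2)[of x] by linarith
qed (simp add: re_inner_self)

text \<open>
  The estimate that makes the functional calculus well defined. It is poly_op_form_ge for the
  polynomial \<open>c\<^sup>2 - p\<^sup>2\<close>, whose form at \<open>x\<close> is \<open>c\<^sup>2 \<parallel>x\<parallel>\<^sup>2 - \<parallel>p(X) x\<parallel>\<^sup>2\<close>.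
\<close>

lemma norm_poly_op_le:
  assumes X: "self_adjoint X" and c: "\<And>s. s \<in> real_spectrum X \<Longrightarrow> \<bar>poly p s\<bar> \<le> c" "0 \<le> c"
  shows "norm (poly_op p X) \<le> c"
proof (rule norm_blinfun_bound)
  fix x
  let ?y = "blinfun_apply (poly_op p X) x"
  have "0 * (norm x)\<^sup>2 \<le> re_inner (blinfun_apply (poly_op ([:c\<^sup>2:] - p * p) X) x) x"
  proof (rule poly_op_form_ge[OF X])
    fix s assume "s \<in> real_spectrum X"
    then have "\<bar>poly p s\<bar>\<^sup>2 \<le> c\<^sup>2" by (intro power_mono c) auto
    then show "0 \<le> poly ([:c\<^sup>2:] - p * p) s" by (simp add: power2_eq_square)
  qed
  also have "\<dots> = (c * norm x)\<^sup>2 - (norm ?y)\<^sup>2"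
    using self_adjointD[OF self_adjoint_poly_op[OF X], of p ?y x]
    by (simp add: poly_op_diff poly_op_mult blinfun.diff_left blinfun.scaleR_left
        re_inner_diff_left re_inner_scaleR_left re_inner_self power_mult_distrib)
  finally have "(norm ?y)\<^sup>2 \<le> (c * norm x)\<^sup>2" by simp
  then show "norm ?y \<le> c * norm x" by (rule power2_le_imp_le) (simp add: c(2))
qed (rule c(2))

lemma weierstrass_poly:
  fixes f :: "real \<Rightarrow> real"
  assumes "compact S" "continuous_on S f"
  obtains p :: "nat \<Rightarrow> real poly" where "uniform_limit S (\<lambda>n. poly (p n)) f sequentially"
proof -
  have "\<exists>p. \<forall>x\<in>S. \<bar>f x - poly p x\<bar> < inverse (real (Suc n))" for n
  proof -
    obtain g where g: "real_polynomial_function g" "\<And>x. x \<in> S \<Longrightarrow> \<bar>f x - g x\<bar> < inverse (real (Suc n))"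
      using Stone_Weierstrass_real_polynomial_function[OF assms, of "inverse (real (Suc n))"] by auto
    then obtain a k where "g = (\<lambda>x. \<Sum>i\<le>k. a i * x ^ i)"
      by (auto simp: real_polynomial_function_iff_sum)
    then have "g x = poly (\<Sum>i\<le>k. monom (a i) i) x" for x by (simp add: poly_sum poly_monom)
    with g(2) show ?thesis by auto
  qed
  then obtain p where p: "\<And>n x. x \<in> S \<Longrightarrow> \<bar>f x - poly (p n) x\<bar> < inverse (real (Suc n))" by metis
  have "uniform_limit S (\<lambda>n. poly (p n)) f sequentially"
    unfolding uniform_limit_sequentially_iff
  proof (intro allI impI)
    fix e :: real assume "e > 0"
    then obtain N where N: "inverse (real (Suc N)) < e" using reals_Archimedean by blast
    have "dist (poly (p n) x) (f x) < e" if "n \<ge> N" "x \<in> S" for n x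
    proof -
      have "inverse (real (Suc n)) \<le> inverse (real (Suc N))" using that(1) by (simp add: field_simps)
      then show ?thesis using p[OF that(2), of n] N
        unfolding dist_real_def abs_minus_commute[of "poly (p n) x"] by linarith
    qed
    then show "\<exists>N. \<forall>n\<ge>N. \<forall>x\<in>S. dist (poly (p n) x) (f x) < e" by blast
  qed
  then show ?thesis by (rule that)
qed

text \<open>
  By norm_poly_op_le, two polynomials that are both close to \<open>f\<close> on the spectrum give operators that
  are close to each other. So the approximations form a Cauchy sequence, and all of them
  share one limit.
\<close>

lemma poly_op_uniform_limit_cfc:
  fixes X :: "'a::chilbert_space \<Rightarrow>\<^sub>L 'a"
  assumes X: "self_adjoint X"
    and p: "uniform_limit (real_spectrum X) (\<lambda>n. poly (p n)) f sequentially"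
  shows "(\<lambda>n. poly_op (p n) X) \<longlonglongrightarrow> cfc f X"
proof -
  have close: "\<exists>N. \<forall>m\<ge>N. \<forall>n\<ge>N. norm (poly_op (q m) X - poly_op (r n) X) < e"
    if q: "uniform_limit (real_spectrum X) (\<lambda>n. poly (q n)) f sequentially"
      and r: "uniform_limit (real_spectrum X) (\<lambda>n. poly (r n)) f sequentially"
      and e: "e > 0" for q r :: "nat \<Rightarrow> real poly" and e :: real
  proof -
    obtain M where M: "\<forall>n\<ge>M. \<forall>x\<in>real_spectrum X. dist (poly (q n) x) (f x) < e / 4"
      using q[unfolded uniform_limit_sequentially_iff, THEN spec, of "e / 4"] e by auto
    obtain N where N: "\<forall>n\<ge>N. \<forall>x\<in>real_spectrum X. dist (poly (r n) x) (f x) < e / 4"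
      using r[unfolded uniform_limit_sequentially_iff, THEN spec, of "e / 4"] e by auto
    have "norm (poly_op (q m) X - poly_op (r n) X) < e" if "m \<ge> max M N" "n \<ge> max M N" for m n
    proof -
      have "norm (poly_op (q m - r n) X) \<le> e / 2"
      proof (rule norm_poly_op_le[OF X])
        fix s assume s: "s \<in> real_spectrum X"
        have "dist (poly (q m) s) (f s) < e / 4" "dist (poly (r n) s) (f s) < e / 4"
          using M N s that by auto
        then show "\<bar>poly (q m - r n) s\<bar> \<le> e / 2" unfolding dist_real_def poly_diff by linarith
      qed (use e in simp)
      then show ?thesis using e by (simp add: poly_op_diff)
    qed
    then show ?thesis by blast
  qed
  have "Cauchy (\<lambda>n. poly_op (p n) X)"
    unfolding Cauchy_iff by (intro allI impI close[OF p p])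
  then obtain Y where Y: "(\<lambda>n. poly_op (p n) X) \<longlonglongrightarrow> Y"
    using Cauchy_convergent convergent_def by blast
  have "cfc f X = Y"
    unfolding cfc_def
  proof (rule the_equality)
    show "\<forall>q. uniform_limit (real_spectrum X) (\<lambda>n. poly (q n)) f sequentially \<longrightarrow>
        (\<lambda>n. poly_op (q n) X) \<longlonglongrightarrow> Y"
    proof (intro allI impI)
      fix q assume q: "uniform_limit (real_spectrum X) (\<lambda>n. poly (q n)) f sequentially"
      have "(\<lambda>n. poly_op (q n) X - poly_op (p n) X) \<longlonglongrightarrow> 0"
      proof (rule LIMSEQ_I)
        fix e :: real assume "e > 0"
        from close[OF q p this] obtain N where
          "\<forall>m\<ge>N. \<forall>n\<ge>N. norm (poly_op (q m) X - poly_op (p n) X) < e" by blast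
        then show "\<exists>N. \<forall>n\<ge>N. norm (poly_op (q n) X - poly_op (p n) X - 0) < e" by auto
      qed
      from tendsto_add[OF this Y] show "(\<lambda>n. poly_op (q n) X) \<longlonglongrightarrow> Y" by simp
    qed
    fix Y' assume "\<forall>q. uniform_limit (real_spectrum X) (\<lambda>n. poly (q n)) f sequentially \<longrightarrow>
        (\<lambda>n. poly_op (q n) X) \<longlonglongrightarrow> Y'"
    with p have "(\<lambda>n. poly_op (p n) X) \<longlonglongrightarrow> Y'" by blast
    with Y show "Y' = Y" by (rule LIMSEQ_unique[rotated])
  qed
  with Y show ?thesis by simp
qed

text \<open>
  A polynomial within \<open>d\<close> of \<open>f\<close> on the spectrum is at least \<open>- d\<close> there, and so is its form on the
  unit sphere; in the limit no negative part is left.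
\<close>

lemma cfc_positive:
  assumes X: "positive_op X" and f: "continuous_on {0..} f" "f \<in> {0..} \<rightarrow> {0..}"
  shows "positive_op (cfc f X)"
proof -
  have sa: "self_adjoint X" using X by (simp add: positive_op_iff)
  have spec: "real_spectrum X \<subseteq> {0..norm X}" using spectrum_positive_op[OF X] by auto
  have "continuous_on {0..norm X} f" by (rule continuous_on_subset[OF f(1)]) auto
  then obtain p where p: "uniform_limit {0..norm X} (\<lambda>n. poly (p n)) f sequentially"
    using weierstrass_poly[of "{0..norm X}" f] by auto
  have lim: "(\<lambda>n. poly_op (p n) X) \<longlonglongrightarrow> cfc f X"
    by (rule poly_op_uniform_limit_cfc[OF sa uniform_limit_on_subset[OF p spec]])
  have "0 \<le> re_inner (blinfun_apply (cfc f X) x) x" for x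
  proof (rule field_le_epsilon)
    fix e :: real assume e: "e > 0"
    define d where "d = e / ((norm x)\<^sup>2 + 1)"
    have pos: "(norm x)\<^sup>2 + 1 > 0" by (simp add: add_nonneg_pos)
    have d: "d > 0" "d * (norm x)\<^sup>2 \<le> e"
      using e pos by (simp_all add: d_def field_simps)
    obtain N where N: "\<forall>n\<ge>N. \<forall>s\<in>{0..norm X}. dist (poly (p n) s) (f s) < d"
      using p d(1) unfolding uniform_limit_sequentially_iff by blast
    have "(\<lambda>n. re_inner (blinfun_apply (poly_op (p n) X) x) x)
        \<longlonglongrightarrow> re_inner (blinfun_apply (cfc f X) x) x"
      by (intro bounded_bilinear.tendsto[OF bounded_bilinear_re_inner] blinfun.tendsto lim tendsto_const)
    moreover have "- d * (norm x)\<^sup>2 \<le> re_inner (blinfun_apply (poly_op (p n) X) x) x" if "n \<ge> N" for n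
    proof (rule poly_op_form_ge[OF sa])
      fix s assume "s \<in> real_spectrum X"
      then have s: "s \<in> {0..norm X}" using spec by auto
      then have "\<bar>poly (p n) s - f s\<bar> < d" using N that by (auto simp: dist_real_def)
      moreover have "0 \<le> f s" using f(2) s by auto
      ultimately show "- d \<le> poly (p n) s" by linarith
    qed
    ultimately have "- d * (norm x)\<^sup>2 \<le> re_inner (blinfun_apply (cfc f X) x) x"
      by (intro LIMSEQ_le_const) auto
    then show "0 \<le> re_inner (blinfun_apply (cfc f X) x) x + e" using d(2) by simp
  qed
  moreover have "self_adjoint (cfc f X)"
    by (rule self_adjoint_limit[OF lim self_adjoint_poly_op[OF sa]])
  ultimately show ?thesis by (simp add: positive_op_iff)
qed

lemma continuous_on_poly_op:
  assumes "continuous_on S X"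
  shows "continuous_on S (\<lambda>t. poly_op p (X t))"
proof (induction p)
  case (pCons a p)
  then show ?case
    unfolding poly_op_pCons
    by (intro continuous_on_add continuous_on_const assms
        bounded_bilinear.continuous_on[OF bounded_bilinear_blinfun_compose])
qed simp

text \<open>
  A norm bound \<open>M\<close> puts all the spectra into \<open>{0..M}\<close>. Polynomials that approximate \<open>f\<close> there
  therefore approximate \<open>f(X t)\<close> uniformly in \<open>t\<close>.
\<close>

lemma continuous_on_cfc:
  fixes X :: "'b::topological_space \<Rightarrow> 'a::chilbert_space \<Rightarrow>\<^sub>L 'a"
  assumes X: "continuous_on S X" "\<And>t. t \<in> S \<Longrightarrow> positive_op (X t)"
    and bound: "\<And>t. t \<in> S \<Longrightarrow> norm (X t) \<le> M"
    and f: "continuous_on {0..} f"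
  shows "continuous_on S (\<lambda>t. cfc f (X t))"
proof -
  have "continuous_on {0..M} f" by (rule continuous_on_subset[OF f]) auto
  then obtain p where p: "uniform_limit {0..M} (\<lambda>n. poly (p n)) f sequentially"
    using weierstrass_poly[of "{0..M}" f] by auto
  have "uniform_limit S (\<lambda>n t. poly_op (p n) (X t)) (\<lambda>t. cfc f (X t)) sequentially"
    unfolding uniform_limit_sequentially_iff
  proof (intro allI impI)
    fix e :: real assume e: "e > 0"
    then obtain N where N: "\<forall>n\<ge>N. \<forall>s\<in>{0..M}. dist (poly (p n) s) (f s) < e / 4"
      using p unfolding uniform_limit_sequentially_iff by (meson zero_less_divide_iff zero_less_numeral)
    have "dist (poly_op (p n) (X t)) (cfc f (X t)) < e" if t: "t \<in> S" and n: "n \<ge> N" for t n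
    proof -
      have sa: "self_adjoint (X t)" using X(2)[OF t] by (simp add: positive_op_iff)
      have spec: "real_spectrum (X t) \<subseteq> {0..M}"
        using spectrum_positive_op[OF X(2)[OF t]] bound[OF t] by force
      have "(\<lambda>m. norm (poly_op (p n) (X t) - poly_op (p m) (X t)))
          \<longlonglongrightarrow> norm (poly_op (p n) (X t) - cfc f (X t))"
        by (intro tendsto_intros poly_op_uniform_limit_cfc[OF sa uniform_limit_on_subset[OF p spec]])
      moreover have "norm (poly_op (p n) (X t) - poly_op (p m) (X t)) \<le> e / 2" if m: "m \<ge> N" for m
        unfolding poly_op_diff[symmetric]
      proof (rule norm_poly_op_le[OF sa])
        fix s assume "s \<in> real_spectrum (X t)"
        then have "dist (poly (p n) s) (f s) < e / 4" "dist (poly (p m) s) (f s) < e / 4"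
          using N spec n m by auto
        then show "\<bar>poly (p n - p m) s\<bar> \<le> e / 2" unfolding dist_real_def poly_diff by linarith
      qed (use e in simp)
      ultimately have "norm (poly_op (p n) (X t) - cfc f (X t)) \<le> e / 2"
        by (intro LIMSEQ_le_const2) auto
      then show ?thesis using e by (simp add: dist_norm)
    qed
    then show "\<exists>N. \<forall>n\<ge>N. \<forall>t\<in>S. dist (poly_op (p n) (X t)) (cfc f (X t)) < e" by blast
  qed
  then show ?thesis
    by (rule uniform_limit_theorem[rotated])
      (auto intro!: always_eventually continuous_on_poly_op X(1))
qed

lemma positive_abs_op:
  assumes A: "A \<in> bounded_ops"
  shows "positive_op (abs_op A)"
  unfolding abs_op_def
proof (rule cfc_positive)
  have form: "re_inner (blinfun_apply (op_adj A o\<^sub>L A) x) y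
      = re_inner (blinfun_apply A x) (blinfun_apply A y)" for x y
    using cinner_op_adj[OF A, of y "blinfun_apply A x"]
    by (metis blinfun_apply_blinfun_compose re_inner_commute re_inner_def)
  show "positive_op (op_adj A o\<^sub>L A)"
    unfolding positive_op_iff self_adjoint_iff
  proof (intro conjI allI)
    show "op_adj A o\<^sub>L A \<in> bounded_ops"
      by (intro bounded_ops_intros op_adj_in_bounded_ops A)
    show "re_inner (blinfun_apply (op_adj A o\<^sub>L A) x) y
        = re_inner x (blinfun_apply (op_adj A o\<^sub>L A) y)" for x y
      using form[of x y] form[of y x] by (simp only: re_inner_commute)
    show "0 \<le> re_inner (blinfun_apply (op_adj A o\<^sub>L A) x) x" for x
      by (simp only: form re_inner_self) simp
  qed
qed (auto intro: continuous_intros)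

section \<open>The Hermite--Hadamard inequality\<close>

text \<open>
  The reflection \<open>t \<mapsto> a + b - t\<close> preserves the integral, so averaging \<open>h\<close> with its reflection does
  not change it, and the average dominates the value at the midpoint.
\<close>

lemma midpoint_le_integral:
  fixes h :: "real \<Rightarrow> real"
  assumes ab: "a \<le> b" and h: "continuous_on {a..b} h"
    and mid: "\<And>t. t \<in> {a..b} \<Longrightarrow> 2 * h ((a + b) / 2) \<le> h t + h (a + b - t)"
  shows "(b - a) * h ((a + b) / 2) \<le> integral {a..b} h"
proof -
  have h1: "(h has_integral integral {a..b} h) {a..b}"
    by (intro integrable_integral integrable_continuous_real h)
  have "(\<lambda>x. a + b - x) ` {a..b} = {a..b}"
    by (auto simp: image_iff intro!: bexI[of _ "a + b - _"])
  then have h2: "((\<lambda>t. h (a + b - t)) has_integral integral {a..b} h) {a..b}"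
    using has_integral_affinity[of h "integral {a..b} h" a b "-1" "a + b"] h1
    by (simp add: algebra_simps)
  have "((\<lambda>t. 2 * h ((a + b) / 2)) has_integral (b - a) * (2 * h ((a + b) / 2))) {a..b}"
    using has_integral_const_real[of "2 * h ((a + b) / 2)" a b] ab by simp
  then have "(b - a) * (2 * h ((a + b) / 2)) \<le> integral {a..b} h + integral {a..b} h"
    using mid by (rule has_integral_le[OF _ has_integral_add[OF h1 h2]])
  then show ?thesis by simp
qed

text \<open>
  1/4 and 3/4 are the midpoints of the two halves of the unit interval.
\<close>

lemma two_point_hermite_hadamard:
  fixes h :: "real \<Rightarrow> real"
  assumes h: "continuous_on {0..1} h"
    and mid: "\<And>s t. s \<in> {0..1} \<Longrightarrow> t \<in> {0..1} \<Longrightarrow> 2 * h ((s + t) / 2) \<le> h s + h t"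
  shows "(h (1 / 4) + h (3 / 4)) / 2 \<le> integral {0..1} h"
proof -
  have "(1 / 2 - 0) * h ((0 + 1 / 2) / 2) \<le> integral {0..1 / 2} h"
    using mid[of t "1 / 2 - t" for t]
    by (intro midpoint_le_integral continuous_on_subset[OF h]) auto
  moreover have "(1 - 1 / 2) * h ((1 / 2 + 1) / 2) \<le> integral {1 / 2..1} h"
    using mid[of t "3 / 2 - t" for t]
    by (intro midpoint_le_integral continuous_on_subset[OF h]) auto
  moreover have "integral {0..1 / 2} h + integral {1 / 2..1} h = integral {0..1} h"
    by (intro Henstock_Kurzweil_Integration.integral_combine integrable_continuous_real h) auto
  ultimately show ?thesis by simp
qed

lemma positive_op_nonneg_combination:
  assumes "positive_op P" "positive_op Q" "0 \<le> a" "0 \<le> b"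
  shows "positive_op (a *\<^sub>R P + b *\<^sub>R Q)"
  using assms
  by (simp add: positive_op_iff self_adjoint_add self_adjoint_scaleR blinfun.add_left
      blinfun.scaleR_left re_inner_add_left re_inner_scaleR_left)

theorem proposition2p2:
  fixes A :: "'h::chilbert_space \<Rightarrow>\<^sub>L 'h" and f :: "real \<Rightarrow> real"
  assumes "A \<in> bounded_ops"
    and "f \<in> {0..} \<rightarrow> {0..}"
    and "operator_convex_on TYPE('h) {0..} f"
  shows "1 / 2 * norm (cfc f ((3 *\<^sub>R abs_op A + abs_op (op_adj A)) /\<^sub>R 4)
                     + cfc f ((abs_op A + 3 *\<^sub>R abs_op (op_adj A)) /\<^sub>R 4))
         \<le> norm (integral {0..1}
                   (\<lambda>t. cfc f (t *\<^sub>R abs_op A + (1 - t) *\<^sub>R abs_op (op_adj A))))"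
proof -
  define P where "P = abs_op A"
  define Q where "Q = abs_op (op_adj A)"
  define W where "W t = t *\<^sub>R P + (1 - t) *\<^sub>R Q" for t :: real
  define g where "g t = cfc f (W t)" for t
  have P: "positive_op P" unfolding P_def by (rule positive_abs_op) fact
  have Q: "positive_op Q"
    unfolding Q_def by (intro positive_abs_op op_adj_in_bounded_ops) fact
  have W: "positive_op (W t)" if "t \<in> {0..1}" for t
    unfolding W_def using that by (intro positive_op_nonneg_combination P Q) auto
  have f: "continuous_on {0..} f" using assms(3) by (simp add: operator_convex_on_def)
  have g_pos: "positive_op (g t)" if "t \<in> {0..1}" for t
    unfolding g_def by (intro cfc_positive W that f assms(2))
  have g_cont: "continuous_on {0..1} g"
    unfolding g_def
  proof (rule continuous_on_cfc[OF _ W _ f])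
    show "continuous_on {0..1} W" unfolding W_def by (intro continuous_intros)
    show "norm (W t) \<le> norm P + norm Q" if "t \<in> {0..1}" for t
    proof -
      have "norm (W t) \<le> t * norm P + (1 - t) * norm Q"
        unfolding W_def using that norm_triangle_ineq[of "t *\<^sub>R P" "(1 - t) *\<^sub>R Q"] by simp
      also have "\<dots> \<le> 1 * norm P + 1 * norm Q"
        using that by (intro add_mono mult_right_mono) auto
      finally show ?thesis by simp
    qed
  qed
  have g_mid: "2 * re_inner (blinfun_apply (g ((s + t) / 2)) x) x
      \<le> re_inner (blinfun_apply (g s) x) x + re_inner (blinfun_apply (g t) x) x"
    if s: "s \<in> {0..1}" and t: "t \<in> {0..1}" for s t x
  proof -
    have "self_adjoint (W u)" "spectrum (W u) \<subseteq> complex_of_real ` {0..}" if "u \<in> {0..1}" for u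
      using W[OF that] spectrum_positive_op[OF W[OF that]] by (auto simp: positive_op_iff)
    with s t assms(3)
    have "op_le (cfc f ((W s + W t) /\<^sub>R 2)) ((cfc f (W s) + cfc f (W t)) /\<^sub>R 2)"
      by (simp add: operator_convex_on_def)
    moreover have "(W s + W t) /\<^sub>R 2 = W ((s + t) / 2)"
      by (simp add: W_def algebra_simps flip: scaleR_add_left)
    ultimately have "positive_op ((g s + g t) /\<^sub>R 2 - g ((s + t) / 2))"
      by (simp add: op_le_def g_def)
    then have "0 \<le> re_inner (blinfun_apply ((g s + g t) /\<^sub>R 2 - g ((s + t) / 2)) x) x"
      by (simp add: positive_op_iff)
    then show ?thesis
      by (simp add: blinfun.diff_left blinfun.scaleR_left blinfun.add_left re_inner_diff_left
          re_inner_scaleR_left re_inner_add_left)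
  qed
  define S where "S = (1 / 2) *\<^sub>R g (3 / 4) + (1 / 2) *\<^sub>R g (1 / 4)"
  have "norm S \<le> norm (integral {0..1} g)"
  proof (rule norm_mono_positive_op)
    show "positive_op S" unfolding S_def by (intro positive_op_nonneg_combination g_pos) auto
    fix x :: 'h
    have bl: "bounded_linear (\<lambda>T. re_inner (blinfun_apply T x) x)"
      by (intro bounded_linear_compose[OF bounded_bilinear.bounded_linear_left[OF bounded_bilinear_re_inner]]
          blinfun.bounded_linear_left)
    have "(re_inner (blinfun_apply (g (1 / 4)) x) x + re_inner (blinfun_apply (g (3 / 4)) x) x) / 2
        \<le> integral {0..1} (\<lambda>t. re_inner (blinfun_apply (g t) x) x)"
      by (intro two_point_hermite_hadamard g_mid bounded_linear.continuous_on[OF bl] g_cont)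
    also have "\<dots> = re_inner (blinfun_apply (integral {0..1} g) x) x"
      using integral_linear[OF integrable_continuous_real[OF g_cont] bl] by (simp add: o_def)
    finally show "re_inner (blinfun_apply S x) x \<le> re_inner (blinfun_apply (integral {0..1} g) x) x"
      by (simp add: S_def blinfun.add_left blinfun.scaleR_left re_inner_add_left re_inner_scaleR_left)
  qed
  moreover have "norm S = 1 / 2 * norm (g (3 / 4) + g (1 / 4))"
  proof -
    have "S = (1 / 2) *\<^sub>R (g (3 / 4) + g (1 / 4))" by (simp add: S_def scaleR_add_right)
    then show ?thesis by simp
  qed
  ultimately have main: "1 / 2 * norm (g (3 / 4) + g (1 / 4)) \<le> norm (integral {0..1} g)"
    by (simp only:)
  have ends: "g (3 / 4) = cfc f ((3 *\<^sub>R P + Q) /\<^sub>R 4)" "g (1 / 4) = cfc f ((P + 3 *\<^sub>R Q) /\<^sub>R 4)"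
    by (simp_all add: g_def W_def scaleR_add_right)
  have integrand: "g = (\<lambda>t. cfc f (t *\<^sub>R P + (1 - t) *\<^sub>R Q))"
    by (simp add: g_def W_def fun_eq_iff)
  show ?thesis
    using main unfolding ends unfolding integrand unfolding P_def Q_def .
qed

end
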